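(* The system $L(\partial)$, where $$L(\partial)=\begin{bmatrix}\Delta^2&0&0&\partial_1\\0&\Delta^2&0&\partial_2\\0&0&\Delta^2&\partial_3\\ \partial_1&\partial_2&\partial_3&0\end{bmatrix}$$ acts on $U=(u_1,u_2,u_3,p)^\top$ on $\mathbb{R}^3$, is elliptic in the sense of Douglis--Nirenberg, with respect to the orders $s=(4,4,4,1)$ for the equations (rows) and $t=(0,0,0,-3)$ for the unknowns (columns).
   Context: With the orders $s_i$ and $t_j$ chosen so that the order of the entry $L_{ij}$ is at most $s_i+t_j$ (the zero operator has order $-\infty$), the principal symbol $\hat L^0(\xi)$, $\xi\in\mathbb{R}^3$, is the matrix obtained by keeping in each entry $L_{ij}(\partial)$ only the terms of order exactly $s_i+t_j$ and replacing $\partial_k$ by $i\xi_k$. The system is elliptic in the sense of Douglis--Nirenberg if $\hat L^0(\xi)$ is invertible for every $\xi\in\mathbb{R}^3\setminus\{0\}$. *)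

theory Defs
  imports "HOL-Analysis.Analysis" "HOL-Library.Poly_Mapping" "HOL-Library.Extended"
begin

text \<open>
  A scalar linear differential operator with constant complex coefficients on \<open>\<real>\<^sup>d\<close>,
  \<open>\<Sum>\<^sub>\<alpha> c\<^sub>\<alpha> \<partial>\<^sup>\<alpha>\<close>, is the finitely supported family of its coefficients, indexed by
  multi-indices. As partial derivatives commute, composition of such operators
  is the (convolution) product of \<^type>\<open>poly_mapping\<close>.
\<close>

type_synonym 'd diffop = "(nat ^ 'd) \<Rightarrow>\<^sub>0 complex"

definition pd :: "'d::finite \<Rightarrow> 'd diffop"
  where "pd k = Poly_Mapping.single (axis k 1) 1"

definition laplacian :: "('d::finite) diffop"
  where "laplacian = (\<Sum>k\<in>UNIV. pd k ^ 2)"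

definition multi_order :: "nat ^ 'd \<Rightarrow> nat"
  where "multi_order \<alpha> = (\<Sum>k\<in>UNIV. \<alpha> $ k)"

definition diffop_order :: "('d::finite) diffop \<Rightarrow> int extended"
  where "diffop_order P =
    (if P = 0 then Minf else Fin (int (Max (multi_order ` Poly_Mapping.keys P))))"

definition symbol_part :: "int \<Rightarrow> ('d::finite) diffop \<Rightarrow> real ^ 'd \<Rightarrow> complex"
  where "symbol_part m P \<xi> =
    (\<Sum>\<alpha> | \<alpha> \<in> Poly_Mapping.keys P \<and> int (multi_order \<alpha>) = m.
       Poly_Mapping.lookup P \<alpha> * (\<Prod>k\<in>UNIV. (\<i> * complex_of_real (\<xi> $ k)) ^ (\<alpha> $ k)))"

definition principal_symbol ::
    "int ^ 'n \<Rightarrow> int ^ 'n \<Rightarrow> ('d::finite) diffop ^ 'n ^ 'n \<Rightarrow> real ^ 'd \<Rightarrow> complex ^ 'n ^ 'n"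
  where "principal_symbol s t L \<xi> = (\<chi> i j. symbol_part (s $ i + t $ j) (L $ i $ j) \<xi>)"

definition DN_elliptic :: "int ^ 'n \<Rightarrow> int ^ 'n \<Rightarrow> ('d::finite) diffop ^ 'n ^ 'n \<Rightarrow> bool"
  where "DN_elliptic s t L \<longleftrightarrow>
    (\<forall>i j. diffop_order (L $ i $ j) \<le> Fin (s $ i + t $ j)) \<and>
    (\<forall>\<xi>. \<xi> \<noteq> 0 \<longrightarrow> invertible (principal_symbol s t L \<xi>))"

definition L_system :: "3 diffop ^ 4 ^ 4"
  where "L_system = vector
    [vector [laplacian ^ 2, 0, 0, pd 1],
     vector [0, laplacian ^ 2, 0, pd 2],
     vector [0, 0, laplacian ^ 2, pd 3],
     vector [pd 1, pd 2, pd 3, 0]]"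

end

theory Submission
  imports Defs
begin

text \<open>
  Every entry of the system is homogeneous of degree exactly \<open>s\<^sub>i + t\<^sub>j\<close> or zero, so the
  principal symbol is the full symbol of the system: with \<open>r = \<Sum>\<^sub>k \<xi>\<^sub>k\<^sup>2\<close> it is

  \<open>[r\<^sup>2 I, \<i>\<xi>; \<i>\<xi>\<^sup>T, 0]\<close>,

  because \<open>\<Delta>\<close> has the symbol \<open>- r\<close>. This is a saddle-point matrix, and its kernel is trivial for
  \<open>\<xi> \<noteq> 0\<close>: for \<open>(u, p)\<close> in the kernel we have \<open>r\<^sup>2 u + \<i> p \<xi> = 0\<close> and \<open>\<xi> \<bullet> u = 0\<close>; pairing the
  first equation with \<open>\<xi>\<close> and using the second one leaves \<open>\<i> p r = 0\<close>, hence \<open>p = 0\<close>, and then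
  \<open>u = 0\<close> as \<open>r \<noteq> 0\<close>. Injectivity gives invertibility, the matrix being square.

  To read off orders and symbols, \<open>\<Delta>\<^sup>2\<close> is expanded into the monomials \<open>\<partial>\<^sub>j\<^sup>2 \<partial>\<^sub>k\<^sup>2\<close>
  (lemma \<open>laplacian_squared\<close>); the symbol is additive, and on a single monomial it is explicit.
\<close>

definition symbol_monomial :: "nat ^ 'd \<Rightarrow> real ^ 'd::finite \<Rightarrow> complex"
  where "symbol_monomial \<alpha> \<xi> = (\<Prod>k\<in>UNIV. (\<i> * complex_of_real (\<xi> $ k)) ^ (\<alpha> $ k))"

lemma symbol_monomial_add:
  "symbol_monomial (\<alpha> + \<beta>) \<xi> = symbol_monomial \<alpha> \<xi> * symbol_monomial \<beta> \<xi>"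
  by (simp add: symbol_monomial_def power_add prod.distrib)

lemma symbol_monomial_axis:
  "symbol_monomial (axis k n) \<xi> = (\<i> * complex_of_real (\<xi> $ k)) ^ n"
proof -
  have "symbol_monomial (axis k n) \<xi> =
      (\<Prod>j\<in>UNIV. if j = k then (\<i> * complex_of_real (\<xi> $ j)) ^ n else 1)"
    unfolding symbol_monomial_def by (rule prod.cong) (auto simp: axis_def)
  then show ?thesis by simp
qed

lemma multi_order_add: "multi_order (\<alpha> + \<beta>) = multi_order \<alpha> + multi_order \<beta>"
  by (simp add: multi_order_def sum.distrib)

lemma multi_order_axis: "multi_order (axis k n :: nat ^ 'd::finite) = n"
  by (simp add: multi_order_def axis_def)

text \<open>
  Summing over an arbitrary finite superset of the support makes the symbol visibly additive,
  in spite of the cancellations that can occur in the support of a sum.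
\<close>

lemma symbol_part_superset:
  assumes "finite S" and "Poly_Mapping.keys P \<subseteq> S"
  shows "symbol_part m P \<xi> =
    (\<Sum>\<alpha>\<in>S. if int (multi_order \<alpha>) = m then Poly_Mapping.lookup P \<alpha> * symbol_monomial \<alpha> \<xi> else 0)"
proof -
  have "symbol_part m P \<xi> =
      (\<Sum>\<alpha>\<in>{\<alpha> \<in> S. int (multi_order \<alpha>) = m}. Poly_Mapping.lookup P \<alpha> * symbol_monomial \<alpha> \<xi>)"
    unfolding symbol_part_def symbol_monomial_def
    using assms by (intro sum.mono_neutral_left) (auto simp: in_keys_iff)
  then show ?thesis
    by (simp add: sum.inter_filter assms(1))
qed

lemma symbol_part_zero [simp]: "symbol_part m 0 \<xi> = 0"
  by (simp add: symbol_part_def)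

lemma symbol_part_add: "symbol_part m (P + Q) \<xi> = symbol_part m P \<xi> + symbol_part m Q \<xi>"
proof -
  let ?S = "Poly_Mapping.keys P \<union> Poly_Mapping.keys Q"
  have *: "finite ?S" "Poly_Mapping.keys P \<subseteq> ?S" "Poly_Mapping.keys Q \<subseteq> ?S"
      "Poly_Mapping.keys (P + Q) \<subseteq> ?S"
    using Poly_Mapping.keys_add[of P Q] by auto
  show ?thesis
    unfolding symbol_part_superset[OF *(1,2)] symbol_part_superset[OF *(1,3)]
      symbol_part_superset[OF *(1,4)] sum.distrib[symmetric]
    by (rule sum.cong) (auto simp: lookup_add distrib_right)
qed

lemma symbol_part_sum: "symbol_part m (\<Sum>i\<in>I. P i) \<xi> = (\<Sum>i\<in>I. symbol_part m (P i) \<xi>)"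
  by (induction I rule: infinite_finite_induct) (simp_all add: symbol_part_add)

lemma symbol_part_single:
  "symbol_part m (Poly_Mapping.single \<alpha> c) \<xi> =
    (if int (multi_order \<alpha>) = m then c * symbol_monomial \<alpha> \<xi> else 0)"
  by (subst symbol_part_superset[of "{\<alpha>}"]) auto

lemma diffop_order_le:
  assumes "\<And>\<alpha>. \<alpha> \<in> Poly_Mapping.keys P \<Longrightarrow> int (multi_order \<alpha>) \<le> m"
  shows "diffop_order P \<le> Fin m"
proof (cases "P = 0")
  case False
  then have "Max (multi_order ` Poly_Mapping.keys P) \<in> multi_order ` Poly_Mapping.keys P"
    by (intro Max_in) auto
  then have "int (Max (multi_order ` Poly_Mapping.keys P)) \<le> m"
    using assms by fastforce
  then show ?thesis
    using False by (simp add: diffop_order_def)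
qed (simp add: diffop_order_def)

lemma laplacian_squared:
  "(laplacian :: ('d::finite) diffop) ^ 2 =
    (\<Sum>j\<in>UNIV. \<Sum>k\<in>UNIV. Poly_Mapping.single (axis j 2 + axis k 2) 1)"
proof -
  have "axis k 1 + axis k 1 = (axis k 2 :: nat ^ 'd)" for k
    by (simp add: vec_eq_iff axis_def)
  then have "pd k ^ 2 = (Poly_Mapping.single (axis k 2) 1 :: 'd diffop)" for k
    by (simp add: pd_def power2_eq_square mult_single)
  then show ?thesis
    by (simp add: laplacian_def power2_eq_square[of "sum _ _"] sum_product mult_single)
qed

lemma diffop_order_pd: "diffop_order (pd k) \<le> Fin 1"
  by (rule diffop_order_le) (simp add: pd_def multi_order_axis)

lemma diffop_order_bilaplacian: "diffop_order (laplacian ^ 2 :: ('d::finite) diffop) \<le> Fin 4"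
proof (rule diffop_order_le)
  fix \<alpha> assume "\<alpha> \<in> Poly_Mapping.keys (laplacian ^ 2 :: 'd diffop)"
  then obtain j k where "\<alpha> = axis j 2 + axis k 2"
    unfolding laplacian_squared by (auto dest!: subsetD[OF keys_sum])
  then show "int (multi_order \<alpha>) \<le> 4"
    by (simp add: multi_order_add multi_order_axis)
qed

lemma symbol_part_pd: "symbol_part 1 (pd k) \<xi> = \<i> * complex_of_real (\<xi> $ k)"
  by (simp add: pd_def symbol_part_single multi_order_axis symbol_monomial_axis)

lemma symbol_part_bilaplacian:
  "symbol_part 4 (laplacian ^ 2) \<xi> = complex_of_real ((\<xi> \<bullet> \<xi>) ^ 2)"
proof -
  have "symbol_part 4 (laplacian ^ 2) \<xi> =
      (\<Sum>j\<in>UNIV. \<Sum>k\<in>UNIV. (\<i> * complex_of_real (\<xi> $ j)) ^ 2 * (\<i> * complex_of_real (\<xi> $ k)) ^ 2)"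
    by (simp add: laplacian_squared symbol_part_sum symbol_part_single multi_order_add
        multi_order_axis symbol_monomial_add symbol_monomial_axis)
  also have "\<dots> = complex_of_real ((\<xi> \<bullet> \<xi>) ^ 2)"
    by (simp add: inner_vec_def power2_eq_square sum_product mult_ac)
  finally show ?thesis .
qed

lemma vector_4:
  fixes w x y z :: "'a::zero"
  shows "(vector [w, x, y, z] :: 'a ^ 4) $ 1 = w"
    and "(vector [w, x, y, z] :: 'a ^ 4) $ 2 = x"
    and "(vector [w, x, y, z] :: 'a ^ 4) $ 3 = y"
    and "(vector [w, x, y, z] :: 'a ^ 4) $ 4 = z"
  unfolding vector_def by simp_all

theorem proposition3p3:
  shows "DN_elliptic (vector [4, 4, 4, 1] :: int ^ 4) (vector [0, 0, 0, -3] :: int ^ 4) L_system"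
  unfolding DN_elliptic_def
proof (intro conjI allI impI)
  let ?s = "vector [4, 4, 4, 1] :: int ^ 4" and ?t = "vector [0, 0, 0, -3] :: int ^ 4"
  have zero: "diffop_order (0 :: 3 diffop) \<le> Fin m" for m
    by (rule diffop_order_le) simp
  have "\<forall>i j. diffop_order (L_system $ i $ j) \<le> Fin (?s $ i + ?t $ j)"
    unfolding forall_4 L_system_def vector_4
    by (simp add: zero diffop_order_pd diffop_order_bilaplacian)
  then show "diffop_order (L_system $ i $ j) \<le> Fin (?s $ i + ?t $ j)" for i j
    by blast
next
  fix \<xi> :: "real ^ 3" assume "\<xi> \<noteq> 0"
  let ?M = "principal_symbol (vector [4, 4, 4, 1]) (vector [0, 0, 0, -3]) L_system \<xi>"
  define r where "r = complex_of_real (\<xi> \<bullet> \<xi>)"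
  define a b c where "a = complex_of_real (\<xi> $ 1)" and "b = complex_of_real (\<xi> $ 2)"
    and "c = complex_of_real (\<xi> $ 3)"
  have r0: "r \<noteq> 0" using \<open>\<xi> \<noteq> 0\<close> by (simp add: r_def)
  have r: "r = a * a + b * b + c * c"
    by (simp add: r_def a_def b_def c_def inner_vec_def sum_3)
  have "v = 0" if "?M *v v = 0" for v
  proof -
    have "\<forall>i. (?M *v v) $ i = 0"
      using that by simp
    then have eqs: "r ^ 2 * v $ 1 + \<i> * a * v $ 4 = 0" "r ^ 2 * v $ 2 + \<i> * b * v $ 4 = 0"
        "r ^ 2 * v $ 3 + \<i> * c * v $ 4 = 0" "\<i> * a * v $ 1 + \<i> * b * v $ 2 + \<i> * c * v $ 3 = 0"
      unfolding forall_4 matrix_vector_mult_def principal_symbol_def L_system_def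
      by (simp_all add: sum_4 vector_4 symbol_part_pd symbol_part_bilaplacian
          r_def a_def b_def c_def)
    have div: "a * v $ 1 + b * v $ 2 + c * v $ 3 = 0"
    proof -
      have "\<i> * (a * v $ 1 + b * v $ 2 + c * v $ 3) = 0"
        using eqs(4) by (simp add: algebra_simps)
      then show ?thesis by simp
    qed
    \<comment> \<open>The first three equations, paired with \<open>\<xi>\<close>.\<close>
    have "r ^ 2 * (a * v $ 1 + b * v $ 2 + c * v $ 3) + \<i> * r * v $ 4 =
        a * (r ^ 2 * v $ 1 + \<i> * a * v $ 4) + b * (r ^ 2 * v $ 2 + \<i> * b * v $ 4)
        + c * (r ^ 2 * v $ 3 + \<i> * c * v $ 4)"
    proof -
      have "\<i> * r * v $ 4 = \<i> * (a * a + b * b + c * c) * v $ 4"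
        by (simp only: r)
      then show ?thesis by (simp add: algebra_simps)
    qed
    then have "v $ 4 = 0"
      using r0 by (simp add: eqs div)
    with eqs r0 show "v = 0"
      by (simp add: vec_eq_iff forall_4)
  qed
  then show "invertible ?M"
    by (simp add: invertible_left_inverse matrix_left_invertible_ker)
qed

end
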